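(* Let $d\ge 1$ be an integer, let $a\in\mathbb{C}$, let $(u_1,\ldots,u_d)$ be a vector of orthogonality and let $\{P_n\}_{n\ge 0}$ be its corresponding monic $d$-OPS. Let $(u^{(m)}_1,\ldots,u^{(m)}_d)$, $m=0,1,\ldots,d$, be vectors of linear functionals with $(u^{(0)}_1,\ldots,u^{(0)}_d)=(u_1,\ldots,u_d)$ and $$(x-a)u^{(m+1)}_1=u^{(m)}_d,\qquad u^{(m+1)}_i=u^{(m)}_{i-1},\quad i=2,\ldots,d,\qquad m=0,1,\ldots,d-1 .$$ Let $m\in\{1,\ldots,d\}$. Then $(u^{(m)}_1,\ldots,u^{(m)}_d)$ is regular if and only if $d^{(m)}_n\neq 0$ for all integers $n\ge 1$, where $$d^{(m)}_n=\begin{vmatrix} \langle u_1^{(m)},P_{0}\rangle&\cdots&\langle u_n^{(m)},P_{0}\rangle\\ \vdots&&\vdots\\ \langle u_1^{(m)},P_{n-1}\rangle&\cdots&\langle u_n^{(m)},P_{n-1}\rangle \end{vmatrix}\quad\text{if } m>n,$$ $$d^{(m)}_n=\begin{vmatrix} \langle u_1^{(m)},P_{n-m}\rangle&\cdots&\langle u_m^{(m)},P_{n-m}\rangle\\ \vdots&&\vdots\\ \langle u_1^{(m)},P_{n-1}\rangle&\cdots&\langle u_m^{(m)},P_{n-1}\rangle \end{vmatrix}\quad\text{if } m\le n.$$ In such case the monic $d$-OPS $\{P^{(m)}_n\}$ associated with $(u^{(m)}_1,\ldots,u^{(m)}_d)$ is given, for $n\ge m$, by $$P_n^{(m)}(x)=\frac{1}{d^{(m)}_n}\begin{vmatrix}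 \langle u_1^{(m)},P_{n-m}\rangle&\cdots&\langle u_m^{(m)},P_{n-m}\rangle&P_{n-m}(x)\\ \vdots&&\vdots&\vdots\\ \langle u_1^{(m)},P_{n-1}\rangle&\cdots&\langle u_m^{(m)},P_{n-1}\rangle&P_{n-1}(x)\\ \langle u_1^{(m)},P_{n}\rangle&\cdots&\langle u_m^{(m)},P_{n}\rangle&P_{n}(x) \end{vmatrix}.$$
   Context: $\mathcal{P}[x]$ is the space of polynomials in $x$ with complex coefficients. A linear functional is a linear map $u:\mathcal{P}[x]\to\mathbb{C}$, $q\mapsto\langle u,q\rangle$, and $(x-a)u$ is the functional defined by $\langle (x-a)u,q\rangle=\langle u,(x-a)q\rangle$. A sequence of polynomials $\{P_n\}_{n\ge0}$ with $\deg P_n=n$ for all $n$ is a $d$-orthogonal sequence ($d$-OPS) with respect to a vector of linear functionals $(u_1,\ldots,u_d)$ if for each $j=1,\ldots,d$: $$\langle u_j,x^kP_n\rangle=0\ \text{ for all } k\ge 0,\ n\ge kd+j,\qquad \langle u_j,x^kP_{dk+j-1}\rangle\neq 0\ \text{ for all } k\ge 0.$$ A vector $(u_1,\ldots,u_d)$ of linear functionals is called regular if such a sequence exists; it is then called a vector of orthogonality for $\{P_n\}$. The $d$-OPS with respect to a given regular vector is unique up to a nonzero constant factor for each polynomial; the monic $d$-OPS is the one in which every $P_n$ has leading coefficient $1$. The functionals $u^{(m)}_i$ are not uniquely determined by the relations in the claim (each step leaves a free additive multiple of the Dirac functional $q\mapsto q(a)$); any choice satisfying the relations is allowed, and the intermediate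 vectors $(u^{(k)}_1,\ldots,u^{(k)}_d)$, $1\le k<m$, are not assumed regular. *)

theory Defs
  imports Complex_Main "HOL-Computational_Algebra.Polynomial" "Jordan_Normal_Form.Determinant"
begin

abbreviation linear_functional :: "(complex poly \<Rightarrow> complex) \<Rightarrow> bool" where
  "linear_functional \<equiv> Vector_Spaces.linear smult (*)"

definition left_mult :: "complex poly \<Rightarrow> (complex poly \<Rightarrow> complex) \<Rightarrow> complex poly \<Rightarrow> complex" where
  "left_mult p u = (\<lambda>q. u (p * q))"

text \<open>A vector \<open>(u\<^sub>1, \<dots>, u\<^sub>d)\<close> is a function on the naturals of which only the values at
  \<open>1, \<dots>, d\<close> matter. Linearity of the entries is always stated separately.\<close>

definition d_OPS :: "nat \<Rightarrow> (nat \<Rightarrow> complex poly \<Rightarrow> complex) \<Rightarrow> (nat \<Rightarrow> complex poly) \<Rightarrow> bool" where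
  "d_OPS d u P \<longleftrightarrow>
     (\<forall>n. P n \<noteq> 0 \<and> degree (P n) = n) \<and>
     (\<forall>j\<in>{1..d}.
        (\<forall>k n. n \<ge> k * d + j \<longrightarrow> u j (monom 1 k * P n) = 0) \<and>
        (\<forall>k. u j (monom 1 k * P (d * k + j - 1)) \<noteq> 0))"

definition monic_d_OPS :: "nat \<Rightarrow> (nat \<Rightarrow> complex poly \<Rightarrow> complex) \<Rightarrow> (nat \<Rightarrow> complex poly) \<Rightarrow> bool" where
  "monic_d_OPS d u P \<longleftrightarrow> d_OPS d u P \<and> (\<forall>n. lead_coeff (P n) = 1)"

definition regular :: "nat \<Rightarrow> (nat \<Rightarrow> complex poly \<Rightarrow> complex) \<Rightarrow> bool" where
  "regular d u \<longleftrightarrow> (\<exists>P. d_OPS d u P)"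

text \<open>Matrix indices start at \<open>0\<close>, indices of functionals at \<open>1\<close>.\<close>

definition geronimus_det ::
    "nat \<Rightarrow> (nat \<Rightarrow> complex poly \<Rightarrow> complex) \<Rightarrow> (nat \<Rightarrow> complex poly) \<Rightarrow> nat \<Rightarrow> complex" where
  "geronimus_det m v P n =
     (if m > n then det (mat n n (\<lambda>(i, j). v (j + 1) (P i)))
      else det (mat m m (\<lambda>(i, j). v (j + 1) (P (n - m + i)))))"

text \<open>The bordered determinant is taken over the polynomial ring, its scalar entries being
  constant polynomials; it is used only for \<open>n \<ge> m\<close>.\<close>

definition geronimus_poly ::
    "nat \<Rightarrow> (nat \<Rightarrow> complex poly \<Rightarrow> complex) \<Rightarrow> (nat \<Rightarrow> complex poly) \<Rightarrow> nat \<Rightarrow> complex poly" where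
  "geronimus_poly m v P n =
     smult (1 / geronimus_det m v P n)
       (det (mat (m + 1) (m + 1)
          (\<lambda>(i, j). if j < m then [:v (j + 1) (P (n - m + i)):] else P (n - m + i))))"

text \<open>A regular vector of linear functionals has a monic sequence, so statements about all its
  monic sequences are not vacuous.\<close>

lemma regular_imp_ex_monic_d_OPS:
  assumes lin: "\<forall>j\<in>{1..d}. linear_functional (u j)" and reg: "regular d u"
  shows "\<exists>P. monic_d_OPS d u P"
proof -
  obtain P where P: "d_OPS d u P"
    using reg by (auto simp: regular_def)
  have nz: "coeff (P n) n \<noteq> 0" for n
    using P by (metis d_OPS_def leading_coeff_0_iff)
  have scale: "u j (smult c p) = c * u j p" if "j \<in> {1..d}" for j c p
    using lin that by (auto simp: Vector_Spaces.linear_iff)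
  have "monic_d_OPS d u (\<lambda>n. smult (inverse (lead_coeff (P n))) (P n))"
    using P nz by (simp add: monic_d_OPS_def d_OPS_def scale)
  then show ?thesis by blast
qed

end

(* Put w_r = (x-a)^k u_j for r = dk + j - 1, 1 <= j <= d.  Then (P_n) is a d-OPS for u precisely
   when the matrix <w_r, P_n> is triangular with nonzero diagonal; replacing x^k by (x-a)^k is a
   triangular change of the functionals.  The relations defining the transformed vector say exactly that
   its sequence w' satisfies w'_(r+m) = w_r, so only the m initial functionals of w' are new.
   Hence a polynomial of degree < n annihilated by w'_0, ..., w'_(n-1) is a combination of
   P_(n-s), ..., P_(n-1) with s = min m n, and its coefficient vector is in the kernel of the transposed
   matrix defining d_n.  Conversely, the bordered determinant of size s + 1 is annihilated by
   w'_0, ..., w'_(n-1), its x^n coefficient is d_n, and its value under w'_n is, up to a nonzero factor,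
   d_(n+1). *)

theory Submission
  imports Defs
begin

section \<open>Polynomials triangular to a sequence of functionals\<close>

lemma linear_functional_iff:
  "linear_functional f \<longleftrightarrow> (\<forall>p q. f (p + q) = f p + f q) \<and> (\<forall>c p. f (smult c p) = c * f p)"
  by (simp add: Vector_Spaces.linear_iff vector_space_def algebra_simps smult_add_right smult_add_left)

lemma linear_functional_sum:
  assumes "linear_functional f"
  shows "f (\<Sum>i\<in>A. g i) = (\<Sum>i\<in>A. f (g i))"
proof (induction A rule: infinite_finite_induct)
  case empty
  have "f (smult 0 0) = 0 * f 0" using assms unfolding linear_functional_iff by blast
  then show ?case by simp
next
  case (infinite A)
  have "f (smult 0 0) = 0 * f 0" using assms unfolding linear_functional_iff by blast
  with infinite show ?case by simp
qed (use assms in \<open>simp add: linear_functional_iff\<close>)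

lemma linear_functional_left_mult:
  assumes "linear_functional f"
  shows "linear_functional (left_mult p f)"
  using assms by (simp add: linear_functional_iff left_mult_def distrib_left)

text \<open>With rows \<open>r\<close> and columns \<open>n\<close>, the values
  \<open>W r (P n)\<close> form a lower triangular matrix with nonzero diagonal. This form forgets
  \<open>d\<close> and the powers of \<open>x\<close>, so a change of the vector becomes a shift of
  the row index.\<close>

definition triangular ::
    "(nat \<Rightarrow> complex poly \<Rightarrow> complex) \<Rightarrow> (nat \<Rightarrow> complex poly) \<Rightarrow> bool" where
  "triangular W P \<longleftrightarrow>
     (\<forall>n. P n \<noteq> 0 \<and> degree (P n) = n) \<and>
     (\<forall>r. (\<forall>n>r. W r (P n) = 0) \<and> W r (P r) \<noteq> 0)"

text \<open>The bound is put on coefficients rather than on the degree, so that \<open>n = 0\<close>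
  means \<open>p = 0\<close> and starts the induction; each step removes the coefficient of x^n with
  a multiple of \<open>P n\<close>.\<close>

lemma degree_sequence_span:
  fixes P :: "nat \<Rightarrow> 'a::field poly"
  assumes deg: "\<And>n. P n \<noteq> 0 \<and> degree (P n) = n"
    and "\<And>k. k \<ge> n \<Longrightarrow> coeff p k = 0"
  shows "\<exists>c. p = (\<Sum>i<n. smult (c i) (P i))"
  using assms(2)
proof (induction n arbitrary: p)
  case 0
  then show ?case by (simp add: poly_eq_iff)
next
  case (Suc n)
  define b where "b = coeff p n / coeff (P n) n"
  have nz: "coeff (P n) n \<noteq> 0" using deg by (metis leading_coeff_0_iff)
  have "coeff (p - smult b (P n)) k = 0" if "k \<ge> n" for k
  proof (cases "k = n")
    case True
    then show ?thesis using nz by (simp add: b_def)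
  next
    case False
    then have "k > n" using that by simp
    then show ?thesis using Suc.prems[of k] deg by (simp add: coeff_eq_0)
  qed
  from Suc.IH[OF this] obtain c where c: "p - smult b (P n) = (\<Sum>i<n. smult (c i) (P i))" by blast
  have "p = (\<Sum>i<Suc n. smult ((c(n := b)) i) (P i))"
    using c by (simp add: algebra_simps)
  then show ?case by blast
qed

text \<open>Forward substitution: in \<open>W i\<close> of the sum, the terms with
  \<open>l < i\<close> vanish by induction and those with \<open>l > i\<close> by triangularity,
  leaving \<open>c i * W i (P i)\<close>.\<close>

lemma triangular_coeffs_zero:
  assumes tri: "triangular W P" and lin: "\<And>r. linear_functional (W r)"
    and zero: "\<And>r. r < k \<Longrightarrow> W r (\<Sum>i<n. smult (c i) (P i)) = 0" and "i < n" "i < k"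
  shows "c i = 0"
  using \<open>i < n\<close> \<open>i < k\<close>
proof (induction i rule: less_induct)
  case (less i)
  have "0 = (\<Sum>l<n. c l * W i (P l))"
    using zero[OF less.prems(2)] lin[of i] by (simp add: linear_functional_sum linear_functional_iff)
  also have "\<dots> = (\<Sum>l<n. if l = i then c i * W i (P i) else 0)"
  proof (rule sum.cong)
    fix l assume "l \<in> {..<n}"
    then show "c l * W i (P l) = (if l = i then c i * W i (P i) else 0)"
      using tri less by (cases l i rule: linorder_cases) (auto simp: triangular_def)
  qed simp
  also have "\<dots> = c i * W i (P i)" using less.prems by simp
  finally show ?case using tri by (auto simp: triangular_def)
qed

text \<open>The uniqueness principle behind both the nonvanishing of the determinants and the
  formula for the monic sequence.\<close>

lemma triangular_annihilated:
  assumes tri: "triangular W P" and lin: "\<And>r. linear_functional (W r)"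
    and zero: "\<And>r. r < n \<Longrightarrow> W r p = 0" and "\<And>k. k \<ge> n \<Longrightarrow> coeff p k = 0"
  shows "p = 0"
proof -
  from degree_sequence_span[of P n p] tri assms(4) obtain c where
    c: "p = (\<Sum>i<n. smult (c i) (P i))" unfolding triangular_def by blast
  have "c i = 0" if "i < n" for i
    using triangular_coeffs_zero[OF tri lin, where n = n and k = n and c = c and i = i] zero that
    unfolding c by blast
  then show ?thesis unfolding c by simp
qed

section \<open>Determinants with a bordering column\<close>

text \<open>An array with \<open>Suc s\<close> rows and \<open>s\<close> columns is completed by a
  last column \<open>c\<close>. Keeping \<open>c\<close> separate displays the determinant as a
  linear function of it.\<close>

definition bordered_mat :: "nat \<Rightarrow> (nat \<Rightarrow> nat \<Rightarrow> 'a) \<Rightarrow> (nat \<Rightarrow> 'a) \<Rightarrow> 'a mat" where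
  "bordered_mat s A c = mat (Suc s) (Suc s) (\<lambda>(i, j). if j < s then A i j else c i)"

lemma bordered_mat_cong:
  assumes "\<And>i. i \<le> s \<Longrightarrow> c i = c' i"
  shows "bordered_mat s A c = bordered_mat s A c'"
  using assms by (auto simp: bordered_mat_def)

text \<open>Laplace expansion along the border; the conditional row index skips row
  \<open>i\<close>, and the minors do not involve \<open>c\<close>.\<close>

lemma det_bordered_mat:
  fixes A :: "nat \<Rightarrow> nat \<Rightarrow> 'a::comm_ring_1"
  shows "det (bordered_mat s A c) =
    (\<Sum>i<Suc s. c i * ((-1) ^ (i + s) * det (mat s s (\<lambda>(k, j). A (if k < i then k else Suc k) j))))"
proof -
  have "mat_delete (bordered_mat s A c) i s = mat s s (\<lambda>(k, j). A (if k < i then k else Suc k) j)" for i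
    by (rule eq_matI) (auto simp: mat_delete_def bordered_mat_def)
  then show ?thesis
    by (subst laplace_expansion_column[of _ "Suc s" s])
      (auto simp: cofactor_def bordered_mat_def intro!: sum.cong)
qed

lemma det_bordered_mat_unit:
  fixes A :: "nat \<Rightarrow> nat \<Rightarrow> 'a::comm_ring_1"
  assumes "k \<le> s"
  shows "det (bordered_mat s A (\<lambda>i. if i = k then x else 0)) =
    x * ((-1) ^ (k + s) * det (mat s s (\<lambda>(i, j). A (if i < k then i else Suc i) j)))"
  using assms unfolding det_bordered_mat if_distrib[of "\<lambda>x. x * _"] mult_zero_left
  by (simp add: sum.delta del: sum.lessThan_Suc)

lemma det_bordered_mat_repeated:
  fixes A :: "nat \<Rightarrow> nat \<Rightarrow> 'a::comm_ring_1"
  assumes "j < s"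
  shows "det (bordered_mat s A (\<lambda>i. A i j)) = 0"
  by (rule det_identical_columns[of _ "Suc s" j s])
    (use assms in \<open>auto simp: bordered_mat_def intro!: eq_vecI\<close>)

lemma det_const_poly:
  "det (mat s s (\<lambda>(i, j). [:A i j:])) = [:det (mat s s (\<lambda>(i, j). A i j)) :: 'a::comm_ring_1:]"
proof -
  interpret const: comm_ring_hom "\<lambda>x::'a. [:x:]"
    by unfold_locales (auto simp: one_pCons)
  have "mat s s (\<lambda>(i, j). [:A i j:]) = map_mat (\<lambda>x. [:x:]) (mat s s (\<lambda>(i, j). A i j))"
    by (rule eq_matI) auto
  then show ?thesis by simp
qed

text \<open>Although \<open>f\<close> is not multiplicative, it passes into the determinant: only
  the border has nonconstant entries, and the minors act on it as scalars.\<close>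

lemma linear_functional_det_bordered_mat:
  assumes "linear_functional f"
  shows "f (det (bordered_mat s (\<lambda>i j. [:A i j:]) p)) = det (bordered_mat s A (\<lambda>i. f (p i)))"
proof -
  have "f (p i * ((-1) ^ (i + s) * [:x:])) = f (p i) * ((-1) ^ (i + s) * x)" for i x
  proof -
    have "p i * ((-1) ^ (i + s) * [:x:]) = smult ((-1) ^ (i + s) * x) (p i)"
      by (cases "even (i + s)") simp_all
    then show ?thesis using assms by (simp add: linear_functional_iff)
  qed
  then show ?thesis
    unfolding det_bordered_mat linear_functional_sum[OF assms] det_const_poly by simp
qed

section \<open>Shifting a sequence of functionals\<close>

text \<open>All that is kept of the Geronimus relations is that dropping the first \<open>m\<close>
  terms of \<open>W'\<close> yields \<open>W\<close>; \<open>v\<close> gives these \<open>m\<close>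
  terms their one-based names.\<close>

locale shifted_triangular =
  fixes W W' :: "nat \<Rightarrow> complex poly \<Rightarrow> complex" and P :: "nat \<Rightarrow> complex poly" and m :: nat
    and v :: "nat \<Rightarrow> complex poly \<Rightarrow> complex"
  assumes linear: "linear_functional (W' r)"
    and shift: "W' (r + m) = W r"
    and triangular: "triangular W P"
    and monic: "lead_coeff (P n) = 1"
    and initial: "j < m \<Longrightarrow> v (Suc j) = W' j"
begin

text \<open>Unites the two cases of the determinant: for \<open>n < m\<close> the rows start at
  \<open>P 0\<close>, otherwise at \<open>P (n - m)\<close>.\<close>

abbreviation size :: "nat \<Rightarrow> nat" where "size n \<equiv> min m n"

abbreviation entry :: "nat \<Rightarrow> nat \<Rightarrow> nat \<Rightarrow> complex" where
  "entry n i j \<equiv> W' j (P (n - size n + i))"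

text \<open>Defined also for \<open>n < m\<close>, where the theorem gives no formula, since
  regularity requires a polynomial of every degree.\<close>

definition bordered_poly :: "nat \<Rightarrow> complex poly" where
  "bordered_poly n =
     det (bordered_mat (size n) (\<lambda>i j. [:entry n i j:]) (\<lambda>i. P (n - size n + i)))"

lemma linear_base: "linear_functional (W r)"
  using linear[of "r + m"] by (simp add: shift)

lemma coeff_P: "coeff (P n) n = 1" "k > n \<Longrightarrow> coeff (P n) k = 0"
  using triangular monic[of n] by (auto simp: triangular_def coeff_eq_0)

lemma geronimus_det_eq:
  "geronimus_det m v P n = det (mat (size n) (size n) (\<lambda>(i, j). entry n i j))"
  by (auto simp: geronimus_det_def initial min_def intro!: arg_cong[of _ _ det])

lemma geronimus_poly_eq:
  assumes "n \<ge> m"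
  shows "geronimus_poly m v P n = smult (1 / geronimus_det m v P n) (bordered_poly n)"
  using assms
  by (auto simp: geronimus_poly_def bordered_poly_def bordered_mat_def initial min_def
      intro!: arg_cong[of _ _ det] arg_cong[of _ _ "smult _"])

lemma functional_bordered_poly:
  assumes "linear_functional f"
  shows "f (bordered_poly n) =
    det (bordered_mat (size n) (entry n) (\<lambda>i. f (P (n - size n + i))))"
  unfolding bordered_poly_def by (rule linear_functional_det_bordered_mat[OF assms])

lemma functional_bordered_poly_zero:
  assumes "linear_functional f" "\<And>i. i \<le> size n \<Longrightarrow> f (P (n - size n + i)) = 0"
  shows "f (bordered_poly n) = 0"
proof -
  have "bordered_mat (size n) (entry n) (\<lambda>i. f (P (n - size n + i))) =
      bordered_mat (size n) (entry n) (\<lambda>i. 0)"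
    by (rule bordered_mat_cong) (rule assms(2))
  then show ?thesis
    unfolding functional_bordered_poly[OF assms(1)] by (simp add: det_bordered_mat)
qed

section \<open>Leading coefficient and moments of the bordered polynomial\<close>

lemma linear_coeff: "linear_functional (\<lambda>p. coeff p k)"
  by (simp add: linear_functional_iff)

text \<open>Taking a coefficient is itself a linear functional. At x^n it turns the border into the
  last unit vector, whose minor is \<open>geronimus_det m v P n\<close>; above x^n the border is
  zero.\<close>

lemma coeff_bordered_poly:
  "coeff (bordered_poly n) n = geronimus_det m v P n"
  "k > n \<Longrightarrow> coeff (bordered_poly n) k = 0"
proof -
  have column: "bordered_mat (size n) (entry n) (\<lambda>i. coeff (P (n - size n + i)) n) =
      bordered_mat (size n) (entry n) (\<lambda>i. if i = size n then 1 else 0)"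
    by (rule bordered_mat_cong) (auto simp: coeff_P)
  have minor: "mat (size n) (size n) (\<lambda>(i, j). entry n (if i < size n then i else Suc i) j) =
      mat (size n) (size n) (\<lambda>(i, j). entry n i j)"
    by (rule eq_matI) auto
  then show "coeff (bordered_poly n) n = geronimus_det m v P n"
    unfolding functional_bordered_poly[OF linear_coeff] geronimus_det_eq column
      det_bordered_mat_unit[OF order_refl] minor by simp
  show "coeff (bordered_poly n) k = 0" if "k > n"
    by (rule functional_bordered_poly_zero[OF linear_coeff], rule coeff_P(2)) (use that in arith)
qed

text \<open>For \<open>j < size n\<close> the border repeats column \<open>j\<close>. Otherwise
  \<open>W' j = W (j - m)\<close>, and every \<open>P\<close> in the border has index greater than
  \<open>j - m\<close>.\<close>

lemma annihilate_bordered_poly: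
  assumes "j < n"
  shows "W' j (bordered_poly n) = 0"
proof (cases "j < size n")
  case True
  show ?thesis
    unfolding functional_bordered_poly[OF linear] by (rule det_bordered_mat_repeated[OF True])
next
  case False
  with assms have j: "j \<ge> m" "size n = m" by auto
  then have "W' j = W (j - m)" using shift[of "j - m"] by simp
  then show ?thesis
    using functional_bordered_poly_zero[OF linear[of j], of n] triangular j assms
    by (simp add: triangular_def)
qed

text \<open>For \<open>n < m\<close> the border is the new column of the next determinant. For
  \<open>n >= m\<close> only its top entry \<open>W (n - m) (P (n - m))\<close> survives, and the
  minor of that entry is the next determinant.\<close>

lemma diagonal_bordered_poly:
  assumes "geronimus_det m v P (Suc n) \<noteq> 0"
  shows "W' n (bordered_poly n) \<noteq> 0"
proof (cases "n < m")
  case True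
  have "mat (Suc n) (Suc n) (\<lambda>(i, j). entry (Suc n) i j) =
      bordered_mat (size n) (entry n) (\<lambda>i. W' n (P (n - size n + i)))"
    using True by (intro eq_matI) (auto simp: bordered_mat_def min_def less_Suc_eq)
  moreover have "size (Suc n) = Suc n" using True by simp
  ultimately show ?thesis
    using assms unfolding functional_bordered_poly[OF linear] geronimus_det_eq by metis
next
  case False
  then have n: "size n = m" "size (Suc n) = m" by auto
  have W: "W' n = W (n - m)" using shift[of "n - m"] False by simp
  have "bordered_mat m (entry n) (\<lambda>i. W' n (P (n - m + i))) =
      bordered_mat m (entry n) (\<lambda>i. if i = 0 then W (n - m) (P (n - m)) else 0)"
    using triangular unfolding W by (intro bordered_mat_cong) (auto simp: triangular_def)
  moreover have "mat m m (\<lambda>(i, j). entry n (if i < 0 then i else Suc i) j) =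
      mat m m (\<lambda>(i, j). entry (Suc n) i j)"
    using False by (auto simp: n Suc_diff_le)
  ultimately have "W' n (bordered_poly n) =
      W (n - m) (P (n - m)) * ((-1) ^ m * geronimus_det m v P (Suc n))"
    unfolding functional_bordered_poly[OF linear] geronimus_det_eq n
    by (simp add: det_bordered_mat_unit n)
  then show ?thesis using assms triangular by (simp add: triangular_def)
qed

section \<open>Nonvanishing determinants, existence and uniqueness of the new sequence\<close>

lemma geronimus_det_nonzero:
  assumes Q: "triangular W' Q"
  shows "geronimus_det m v P n \<noteq> 0"
proof
  assume "geronimus_det m v P n = 0"
  \<comment> \<open>Rows belong to polynomials and columns to functionals, so coefficients of an
    annihilated combination form a kernel vector of the transpose.\<close>
  then have "det (mat (size n) (size n) (\<lambda>(i, j). entry n i j))\<^sup>T = 0"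
    unfolding geronimus_det_eq by (subst det_transpose[where n = "size n"]) auto
  then obtain c where c: "c \<in> carrier_vec (size n)" "c \<noteq> 0\<^sub>v (size n)"
      and ker: "(mat (size n) (size n) (\<lambda>(i, j). entry n i j))\<^sup>T *\<^sub>v c = 0\<^sub>v (size n)"
    using det_0_iff_vec_prod_zero[of "(mat (size n) (size n) (\<lambda>(i, j). entry n i j))\<^sup>T" "size n"]
    by auto
  \<comment> \<open>The kernel vector is padded with zeros in front, making it a coefficient list
    for all of \<open>P 0\<close>, ..., \<open>P (n - 1)\<close>.\<close>
  define b where "b l = (if l < n - size n then 0 else c $ (l - (n - size n)))" for l
  have b_low: "b l = 0" if "l < n - size n" for l
    using that by (simp add: b_def)
  have b_high: "b (n - size n + i) = c $ i" for i
    by (simp only: b_def add_diff_cancel_left' not_add_less1 if_False)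
  define p where "p = (\<Sum>l<n. smult (b l) (P l))"
  have functional: "f p = (\<Sum>i<size n. c $ i * f (P (n - size n + i)))" if "linear_functional f" for f
  proof -
    have "f p = (\<Sum>l<n - size n + size n. b l * f (P l))"
      using that by (simp add: p_def linear_functional_sum) (simp add: linear_functional_iff)
    also have "\<dots> = (\<Sum>l<n - size n. b l * f (P l)) +
        (\<Sum>i<size n. b (n - size n + i) * f (P (n - size n + i)))"
      proof -
      have "(\<Sum>l<a + b. g l) = (\<Sum>l<a. g l) + (\<Sum>i<b. g (a + i))" for a b and g :: "nat \<Rightarrow> complex"
        by (induction b) (simp_all add: add.assoc)
      then show ?thesis .
    qed
    also have "\<dots> = (\<Sum>i<size n. c $ i * f (P (n - size n + i)))"
      unfolding b_high by (simp add: b_low)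
    finally show ?thesis .
  qed
  have "W' j p = 0" if "j < n" for j
  proof (cases "j < size n")
    case True
    have "(\<Sum>i<size n. entry n i j * c $ i) =
        ((mat (size n) (size n) (\<lambda>(i, j). entry n i j))\<^sup>T *\<^sub>v c) $ j"
      using True c(1) by (auto simp: scalar_prod_def lessThan_atLeast0 intro!: sum.cong)
    also have "\<dots> = 0" unfolding ker using True by simp
    finally show ?thesis using functional[OF linear[of j]] by (simp add: mult.commute)
  next
    case False
    with that have j: "j \<ge> m" "size n = m" by auto
    then have "W' j = W (j - m)" using shift[of "j - m"] by simp
    then show ?thesis
      using functional[OF linear[of j]] triangular j that by (simp add: triangular_def)
  qed
  moreover have "coeff p k = 0" if "k \<ge> n" for k
    unfolding functional[OF linear_coeff]
  proof (rule sum.neutral, rule ballI)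
    fix i assume "i \<in> {..<size n}"
    then have "n - size n + i < k" using that unfolding lessThan_iff by arith
    then show "c $ i * coeff (P (n - size n + i)) k = 0" by (simp only: coeff_P(2) mult_zero_right)
  qed
  ultimately have "p = 0" by (rule triangular_annihilated[OF Q linear])
  \<comment> \<open>Every \<open>W r\<close> annihilates the zero polynomial, so triangularity of
    \<open>P\<close> for the original \<open>W\<close> recovers \<open>b l = 0\<close> for
    \<open>l < n\<close>, contradicting the choice of \<open>c\<close>.\<close>
  then have "W r p = 0" for r
    using functional[OF linear_base[of r]] linear_functional_sum[OF linear_base[of r], of "\<lambda>_. 0" "{}"]
    by simp
  then have "b l = 0" if "l < n" for l
    using triangular_coeffs_zero[OF triangular linear_base, where n = n and k = n and c = b and i = l] that
    by (simp add: p_def)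
  then have "c $ i = 0" if "i < size n" for i
  proof -
    have "n - size n + i < n" using that by arith
    then show ?thesis using \<open>\<And>l. l < n \<Longrightarrow> b l = 0\<close> unfolding b_high[symmetric] by blast
  qed
  with c show False by (auto intro: eq_vecI)
qed

lemma triangular_normalized_bordered_poly:
  assumes "\<forall>n\<ge>1. geronimus_det m v P n \<noteq> 0"
  shows "triangular W' (\<lambda>n. smult (1 / geronimus_det m v P n) (bordered_poly n))"
proof -
  \<comment> \<open>At \<open>n = 0\<close> the determinant is empty and equals 1.\<close>
  have nz: "geronimus_det m v P n \<noteq> 0" for n
    using assms by (cases "n = 0") (auto simp: geronimus_det_eq)
  have "bordered_poly n \<noteq> 0 \<and> degree (bordered_poly n) = n" for n
    using nz[of n] coeff_bordered_poly[where n = n]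
    by (metis coeff_0 degree_le le_antisym le_degree)
  then show ?thesis
    using linear annihilate_bordered_poly diagonal_bordered_poly nz
    by (auto simp: triangular_def linear_functional_iff)
qed

text \<open>Both sides are monic of degree \<open>n\<close>, so their difference has smaller degree,
  and it is annihilated by the first \<open>n\<close> functionals.\<close>

lemma monic_triangular_eq:
  assumes Q: "triangular W' Q" and lead: "lead_coeff (Q n) = 1"
  shows "Q n = smult (1 / geronimus_det m v P n) (bordered_poly n)" (is "_ = ?R")
proof -
  have "Q n - ?R = 0"
  proof (rule triangular_annihilated[OF Q linear])
    have diff: "f (p - smult b q) = f p - b * f q" if "linear_functional f" for f b p q
      using that unfolding linear_functional_iff
      by (metis add_diff_cancel_right' diff_add_cancel)
    show "W' r (Q n - ?R) = 0" if "r < n" for r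
      using that Q by (simp add: diff[OF linear] annihilate_bordered_poly triangular_def)
    show "coeff (Q n - ?R) k = 0" if "k \<ge> n" for k
    proof (cases "k = n")
      case True
      then show ?thesis
        using Q lead geronimus_det_nonzero[OF Q, of n]
        by (simp add: coeff_bordered_poly triangular_def)
    next
      case False
      then have "k > n" using that by simp
      then show ?thesis using Q by (simp add: coeff_bordered_poly triangular_def coeff_eq_0)
    qed
  qed
  then show ?thesis by simp
qed

end

section \<open>Vectors of functionals as sequences\<close>

text \<open>Division of \<open>r\<close> by \<open>d\<close> yields the exponent and the entry of
  the vector. Center 0 gives the moments in \<open>d_OPS\<close>; center \<open>a\<close> makes
  multiplication by \<open>x - a\<close> a shift of \<open>r\<close> by \<open>d\<close>.\<close>

definition power_functional ::
    "nat \<Rightarrow> complex \<Rightarrow> (nat \<Rightarrow> complex poly \<Rightarrow> complex) \<Rightarrow> nat \<Rightarrow> complex poly \<Rightarrow> complex" where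
  "power_functional d a u r = left_mult ([:-a, 1:] ^ (r div d)) (u (Suc (r mod d)))"

text \<open>Expanding \<open>x - c\<close> as \<open>(x - b) + (b - c)\<close> by the binomial
  theorem, only the top power survives.\<close>

lemma power_center_change:
  assumes lin: "linear_functional f"
    and zero: "\<And>i. i < k \<Longrightarrow> f ([:-b, 1:] ^ i * p) = 0"
  shows "f ([:-c, 1:] ^ k * p) = f ([:-b, 1:] ^ k * p)"
proof -
  have "[:-c, 1:] = [:-b, 1:] + [:b - c:]" by simp
  then have "[:-c, 1:] ^ k * p =
      (\<Sum>i\<le>k. smult (of_nat (k choose i) * (b - c) ^ (k - i)) ([:-b, 1:] ^ i * p))"
    by (simp only: binomial_ring sum_distrib_right)
      (simp add: of_nat_poly poly_const_pow mult.assoc mult.commute)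
  then have "f ([:-c, 1:] ^ k * p) =
      (\<Sum>i\<le>k. of_nat (k choose i) * (b - c) ^ (k - i) * f ([:-b, 1:] ^ i * p))"
    using lin by (simp add: linear_functional_sum) (simp add: linear_functional_iff)
  also have "\<dots> = (\<Sum>i<k. 0) + f ([:-b, 1:] ^ k * p)"
    unfolding lessThan_Suc_atMost[symmetric] sum.lessThan_Suc by (simp add: zero)
  finally show ?thesis by simp
qed

lemma triangular_power_center_change:
  assumes d: "d \<ge> 1" and lin: "\<forall>j\<in>{1..d}. linear_functional (u j)"
    and tri: "triangular (power_functional d b u) P"
  shows "triangular (power_functional d c u) P"
proof -
  \<comment> \<open>Entries with \<open>n < r\<close> may change with the center, but triangularity
    does not see them.\<close>
  have "power_functional d c u r (P n) = power_functional d b u r (P n)" if "r \<le> n" for r n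
    unfolding power_functional_def left_mult_def
  proof (rule power_center_change)
    show "linear_functional (u (Suc (r mod d)))" using lin d by (simp add: Suc_le_eq)
  next
    fix i assume i: "i < r div d"
    \<comment> \<open>The index of the same entry of the vector with the lower exponent
      \<open>i\<close>; it satisfies \<open>s < r <= n\<close>.\<close>
    define s where "s = d * i + r mod d"
    have s: "s div d = i" "s mod d = r mod d" using d by (auto simp: s_def)
    have "d * i < d * (r div d)" using i d by simp
    then have "s < n" using that mult_div_mod_eq[of d r] by (simp only: s_def)
    then have "power_functional d b u s (P n) = 0" using tri by (simp add: triangular_def)
    then show "u (Suc (r mod d)) ([:-b, 1:] ^ i * P n) = 0"
      by (simp add: power_functional_def left_mult_def s)
  qed
  with tri show ?thesis by (simp add: triangular_def)
qed

lemma d_OPS_iff_triangular_zero: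
  assumes d: "d \<ge> 1"
  shows "d_OPS d u P \<longleftrightarrow> triangular (power_functional d 0 u) P"
proof -
  have index: "power_functional d 0 u (d * k + j - 1) p = u j (monom 1 k * p)"
    if "j \<in> {1..d}" for j k p
  proof -
    have *: "d * k + j - 1 = d * k + (j - 1)" and "j - 1 < d" using that by auto
    then have "(d * k + j - 1) div d = k" "(d * k + j - 1) mod d = j - 1"
      unfolding * using d by (auto simp: div_mult_self4)
    then show ?thesis using that
      by (simp add: power_functional_def left_mult_def monom_altdef)
  qed
  \<comment> \<open>Every \<open>r\<close> is \<open>d * k + j - 1\<close> with
    \<open>k = r div d\<close> and \<open>j = r mod d + 1\<close>.\<close>
  have all: "(\<forall>r. A r) \<longleftrightarrow> (\<forall>j\<in>{1..d}. \<forall>k. A (d * k + j - 1))" for A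
  proof
    assume R: "\<forall>j\<in>{1..d}. \<forall>k. A (d * k + j - 1)"
    show "\<forall>r. A r"
    proof
      fix r
      have "Suc (r mod d) \<in> {1..d}" using d by (simp add: Suc_le_eq)
      with R have "A (d * (r div d) + Suc (r mod d) - 1)" by blast
      then show "A r" by simp
    qed
  qed blast
  have "(\<forall>r. (\<forall>n>r. power_functional d 0 u r (P n) = 0) \<and> power_functional d 0 u r (P r) \<noteq> 0) \<longleftrightarrow>
      (\<forall>j\<in>{1..d}. \<forall>k. (\<forall>n>d * k + j - 1. u j (monom 1 k * P n) = 0) \<and>
        u j (monom 1 k * P (d * k + j - 1)) \<noteq> 0)"
    by (subst all) (simp add: index[unfolded One_nat_def])
  also have "\<dots> \<longleftrightarrow> (\<forall>j\<in>{1..d}.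
        (\<forall>k n. n \<ge> k * d + j \<longrightarrow> u j (monom 1 k * P n) = 0) \<and>
        (\<forall>k. u j (monom 1 k * P (d * k + j - 1)) \<noteq> 0))"
  proof (rule ball_cong)
    fix j assume "j \<in> {1..d}"
    then have "n > d * k + j - 1 \<longleftrightarrow> n \<ge> k * d + j" for k n by (auto simp: mult.commute)
    then show "(\<forall>k. (\<forall>n>d * k + j - 1. u j (monom 1 k * P n) = 0) \<and>
        u j (monom 1 k * P (d * k + j - 1)) \<noteq> 0) \<longleftrightarrow>
        (\<forall>k n. n \<ge> k * d + j \<longrightarrow> u j (monom 1 k * P n) = 0) \<and>
        (\<forall>k. u j (monom 1 k * P (d * k + j - 1)) \<noteq> 0)" by auto
  qed simp
  finally show ?thesis unfolding d_OPS_def triangular_def by simp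
qed

lemma d_OPS_iff_triangular:
  assumes "d \<ge> 1" "\<forall>j\<in>{1..d}. linear_functional (u j)"
  shows "d_OPS d u P \<longleftrightarrow> triangular (power_functional d a u) P"
  using d_OPS_iff_triangular_zero[OF assms(1)] triangular_power_center_change[OF assms] by blast

lemma power_functional_initial:
  assumes "j < d"
  shows "power_functional d a u j = u (Suc j)"
  using assms by (simp add: power_functional_def left_mult_def)

text \<open>Passing from \<open>r\<close> to \<open>Suc r\<close> either moves to the next entry of
  \<open>v\<close>, which is the current entry of \<open>u\<close>, or wraps around to
  \<open>v 1\<close> with one more factor \<open>x - a\<close>, which turns \<open>v 1\<close> into
  \<open>u d\<close>.\<close>

lemma power_functional_shift:
  assumes d: "d \<ge> 1"
    and first: "left_mult [:-a, 1:] (v 1) = u d"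
    and rest: "\<And>i. i \<in> {2..d} \<Longrightarrow> v i = u (i - 1)"
  shows "power_functional d a v (Suc r) = power_functional d a u r"
proof (cases "Suc (r mod d) = d")
  case True
  then have "Suc r mod d = 0" "Suc r div d = Suc (r div d)"
    by (auto simp: mod_Suc div_Suc)
  moreover have "v 1 ([:-a, 1:] * p) = u d p" for p
    using fun_cong[OF first, of p] by (simp add: left_mult_def)
  ultimately show ?thesis
    using True by (auto simp: power_functional_def left_mult_def fun_eq_iff mult.assoc mult.left_commute
        simp del: mult_pCons_left)
next
  case False
  then have "Suc r mod d = Suc (r mod d)" "Suc r div d = r div d"
    by (auto simp: mod_Suc div_Suc)
  moreover have "Suc (r mod d) < d" using False d by (simp add: Suc_lessI)
  ultimately show ?thesis using rest[of "Suc (Suc (r mod d))"]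
    by (simp add: power_functional_def)
qed

section \<open>The Geronimus relations as an \<open>m\<close>-fold shift\<close>

theorem theorem2:
  fixes d m :: nat and a :: complex
    and u :: "nat \<Rightarrow> complex poly \<Rightarrow> complex"
    and P :: "nat \<Rightarrow> complex poly"
    and U :: "nat \<Rightarrow> nat \<Rightarrow> complex poly \<Rightarrow> complex"
  assumes "d \<ge> 1"
    and "\<forall>i\<in>{1..d}. linear_functional (u i)"
    and "monic_d_OPS d u P"
    and "\<forall>k\<in>{0..d}. \<forall>i\<in>{1..d}. linear_functional (U k i)"
    and "\<forall>i\<in>{1..d}. U 0 i = u i"
    and "\<forall>k<d. left_mult [:-a, 1:] (U (k + 1) 1) = U k d"
    and "\<forall>k<d. \<forall>i\<in>{2..d}. U (k + 1) i = U k (i - 1)"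
    and "m \<in> {1..d}"
  shows "(regular d (U m) \<longleftrightarrow> (\<forall>n\<ge>1. geronimus_det m (U m) P n \<noteq> 0)) \<and>
    (regular d (U m) \<longrightarrow>
      (\<forall>Q. monic_d_OPS d (U m) Q \<longrightarrow> (\<forall>n\<ge>m. Q n = geronimus_poly m (U m) P n)))"
proof -
  define W where "W k = power_functional d a (U k)" for k
  have lin: "\<forall>i\<in>{1..d}. linear_functional (U k i)" if "k \<le> d" for k
    using assms(4) that by simp
  have ops: "d_OPS d (U k) Q \<longleftrightarrow> triangular (W k) Q" if "k \<le> d" for k Q
    unfolding W_def by (rule d_OPS_iff_triangular[OF assms(1) lin[OF that]])
  have step: "W (Suc k) (Suc r) = W k r" if "k < d" for k r
    unfolding W_def using assms(1,6,7) that by (intro power_functional_shift) auto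
  \<comment> \<open>Each transformation puts one new functional in front of the sequence, so
    \<open>k\<close> of them shift the original by \<open>k\<close>.\<close>
  have shift: "W k (r + k) = W 0 r" if "k \<le> d" for k r
    using that by (induction k) (auto simp: step)
  have "d_OPS d (U 0) P"
    using assms(3,5) by (simp add: monic_d_OPS_def d_OPS_def)
  then have tri: "triangular (W 0) P" by (simp add: ops)
  have m: "m \<le> d" using assms(8) by simp
  interpret shifted_triangular "W 0" "W m" P m "U m"
  proof (rule shifted_triangular.intro)
    show "linear_functional (W m r)" for r
      unfolding W_def power_functional_def using lin[OF m] assms(1)
      by (intro linear_functional_left_mult) (simp add: Suc_le_eq)
    show "lead_coeff (P n) = 1" for n using assms(3) by (simp add: monic_d_OPS_def)
    show "U m (Suc j) = W m j" if "j < m" for j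
      using that m by (simp add: W_def power_functional_initial)
  qed (use shift[OF m] tri in auto)
  have "regular d (U m) \<longleftrightarrow> (\<forall>n\<ge>1. geronimus_det m (U m) P n \<noteq> 0)"
    unfolding regular_def ops[OF m]
    using geronimus_det_nonzero triangular_normalized_bordered_poly by blast
  moreover have "Q n = geronimus_poly m (U m) P n" if "monic_d_OPS d (U m) Q" "n \<ge> m" for Q n
    using that monic_triangular_eq[of Q n] by (simp add: monic_d_OPS_def ops[OF m] geronimus_poly_eq)
  ultimately show ?thesis by blast
qed

end
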